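(* Suppose $\beta>0$. Then $$D_{\beta,0}=\inf_{\theta\in(0,\psi^{-1}(\beta)]}\Lambda(\beta,\theta).$$
   Context: Let $\mathcal{H}=\{(x,v)\in\mathbb{R}^2:v\ge0\}$ and let $d_H$ be the Riemannian distance on $\mathcal{H}$ induced by the metric $ds^2=v^{-1}(dx^2+dv^2)$ on the open upper half-plane (extended to the boundary). For $\beta,\gamma\in\mathbb{R}$, $D_{\beta,\gamma}=\inf_{v\ge0}\frac12 d_H((0,1),(\beta+\gamma v,v))^2$. The function $\psi(\theta)=\frac{\theta-\sin\theta}{1-\cos\theta}$ is a strictly increasing bijection of $(0,2\pi)$ onto $(0,\infty)$, and $\psi^{-1}$ denotes its inverse. For $\theta\ne0$ and admissible $x$, $$\Lambda(x,\theta)=\frac{\theta^2}{(\theta-\sin\theta)^2}\Big[(\theta-\sin\theta)x+2(1-\cos\theta)-\theta\sin\theta-(1-\cos\theta)\sqrt{2(\theta-\sin\theta)x+2(1-\cos\theta)-\theta^2}\Big],$$ with the nonnegative square root. *)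

theory Defs
  imports "HOL-Analysis.Analysis"
begin

definition Hplane :: "(real \<times> real) set" where
  "Hplane = {p. snd p \<ge> 0}"

text \<open>Pointwise speed for the metric ds^2 = v^{-1}(dx^2+dv^2), extended to the boundary
  v = 0 by the value +infinity (unless the velocity vanishes).\<close>
definition hspeed :: "real \<times> real \<Rightarrow> real \<times> real \<Rightarrow> ennreal" where
  "hspeed p w = (if snd p > 0 then ennreal (sqrt ((norm w)\<^sup>2 / snd p))
                 else if w = 0 then 0 else \<infinity>)"

definition hlength :: "(real \<Rightarrow> real \<times> real) \<Rightarrow> ennreal" where
  "hlength g = (\<integral>\<^sup>+ t. indicator {0..1} t * hspeed (g t) (vector_derivative g (at t)) \<partial>lborel)"

definition hpaths :: "real \<times> real \<Rightarrow> real \<times> real \<Rightarrow> (real \<Rightarrow> real \<times> real) set" where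
  "hpaths p q = {g. g piecewise_C1_differentiable_on {0..1} \<and> g ` {0..1} \<subseteq> Hplane
                    \<and> g 0 = p \<and> g 1 = q}"

definition dH :: "real \<times> real \<Rightarrow> real \<times> real \<Rightarrow> real" where
  "dH p q = enn2real (INF g\<in>hpaths p q. hlength g)"

definition Dbg :: "real \<Rightarrow> real \<Rightarrow> real" where
  "Dbg \<beta> \<gamma> = (INF v\<in>{0::real..}. (1/2) * (dH (0,1) (\<beta> + \<gamma> * v, v))\<^sup>2)"

definition psi :: "real \<Rightarrow> real" where
  "psi \<theta> = (\<theta> - sin \<theta>) / (1 - cos \<theta>)"

definition psi_inv :: "real \<Rightarrow> real" where
  "psi_inv b = (THE \<theta>. \<theta> \<in> {0<..<2*pi} \<and> psi \<theta> = b)"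

definition Lambda :: "real \<Rightarrow> real \<Rightarrow> real" where
  "Lambda x \<theta> = \<theta>\<^sup>2 / (\<theta> - sin \<theta>)\<^sup>2 *
     ((\<theta> - sin \<theta>) * x + 2 * (1 - cos \<theta>) - \<theta> * sin \<theta>
      - (1 - cos \<theta>) * sqrt (2 * (\<theta> - sin \<theta>) * x + 2 * (1 - cos \<theta>) - \<theta>\<^sup>2))"

end

theory Submission
  imports Defs
begin

text \<open>
  Geodesics of \<open>(dx\<^sup>2 + dv\<^sup>2) / v\<close> are cycloids, and a cycloid arc of rolling radius \<open>r\<close> and rolling
  angle \<open>\<theta>\<close> has length \<open>\<theta> sqrt (2 r)\<close>. The cycloids that meet the line \<open>x = \<beta>\<close> at their vertex foliate the
  half-plane, and the signed length to the line along them satisfies the eikonal equation. It is a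
  calibration: no path from \<open>(0, 1)\<close> to the line is shorter than the cycloid of this family through
  \<open>(0, 1)\<close>. On the other hand, \<open>\<Lambda>(\<beta>, \<theta>)\<close> is half the squared length of a cycloid arc of rolling angle
  \<open>\<theta>\<close> from \<open>(0, 1)\<close> to the line, so it is never below this minimum, and it attains it at the rolling angle
  of the optimal cycloid, which lies in the admissible interval.
\<close>

section \<open>Trigonometric preliminaries\<close>

lemma mult_cos_less_sin:
  fixes x :: real
  assumes "0 < x" "x < pi"
  shows "x * cos x < sin x"
proof -
  have "sin 0 - 0 * cos 0 < sin x - x * cos x"
  proof (rule DERIV_pos_imp_increasing_open[OF assms(1)])
    fix t assume t: "0 < t" "t < x"
    have "((\<lambda>t. sin t - t * cos t) has_real_derivative t * sin t) (at t)"
      by (auto intro!: derivative_eq_intros)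
    moreover have "0 < t * sin t"
      using t assms by (intro mult_pos_pos sin_gt_zero) auto
    ultimately show "\<exists>y. ((\<lambda>t. sin t - t * cos t) has_real_derivative y) (at t) \<and> 0 < y"
      by blast
  qed (auto intro!: continuous_intros)
  then show ?thesis by simp
qed

lemma sin_less_self:
  fixes x :: real
  assumes "0 < x"
  shows "sin x < x"
proof (cases "x < pi")
  case True
  have "0 - sin 0 < x - sin x"
  proof (rule DERIV_pos_imp_increasing_open[OF assms])
    fix t assume t: "0 < t" "t < x"
    have "((\<lambda>t. t - sin t) has_real_derivative 1 - cos t) (at t)"
      by (auto intro!: derivative_eq_intros)
    moreover have "0 < 1 - cos t"
      using cos_monotone_0_pi[of 0 t] t True by simp
    ultimately show "\<exists>y. ((\<lambda>t. t - sin t) has_real_derivative y) (at t) \<and> 0 < y"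
      by blast
  qed (auto intro!: continuous_intros)
  then show ?thesis by simp
next
  case False
  then show ?thesis using sin_le_one[of x] pi_gt3 by linarith
qed

lemma cos_less_one:
  fixes x :: real
  assumes "0 < x" "x < 2 * pi"
  shows "cos x < 1"
proof -
  have "0 < sin (x/2)" using assms by (intro sin_gt_zero) auto
  then have "0 < (sin (x/2))\<^sup>2" by simp
  then show ?thesis using cos_double_sin[of "x/2"] by simp
qed

text \<open>The difference of the two sides is the numerator of the derivative of
  \<open>psi\<close>. The bound is \<open>mult_cos_less_sin\<close> at the half angle, multiplied by
  \<open>4 * sin (x/2)\<close>.\<close>

lemma mult_sin_less_versine:
  fixes x :: real
  assumes "0 < x" "x < 2 * pi"
  shows "x * sin x < 2 * (1 - cos x)"
proof -
  have s: "0 < sin (x/2)" using assms by (intro sin_gt_zero) auto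
  have "(x/2) * cos (x/2) < sin (x/2)" using assms by (intro mult_cos_less_sin) auto
  then have "4 * sin (x/2) * ((x/2) * cos (x/2)) < 4 * sin (x/2) * sin (x/2)"
    using s by (intro mult_strict_left_mono) auto
  then show ?thesis
    using cos_double_sin[of "x/2"] sin_double[of "x/2"]
    by (simp add: power2_eq_square algebra_simps)
qed

section \<open>Cycloids meeting a vertical line at a right angle\<close>

text \<open>
  Let a cycloid of rolling radius \<open>r\<close> have its vertex on the vertical line, and take a point of it at
  rolling angle \<open>2 a\<close> from the vertex. That point has height \<open>r (1 + cos (2 a))\<close> and distance
  \<open>r (2 a + sin (2 a))\<close> to the line; \<open>cyc_slope a\<close> is the quotient of the two.
\<close>

definition cyc_slope :: "real \<Rightarrow> real" where
  "cyc_slope a = a / (cos a)\<^sup>2 + tan a"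

text \<open>Half the rolling angle up to the vertex, recovered from signed distance over height. The
  interval ends at the cusps, where the height vanishes.\<close>

definition cyc_angle :: "real \<Rightarrow> real" where
  "cyc_angle = inv_into {-pi/2<..<pi/2} cyc_slope"

text \<open>On this interval \<open>a\<close> and \<open>sin a\<close> have the same sign. The sum
  decides the sign of the derivative of \<open>cyc_slope\<close>.\<close>

lemma cos_add_mult_sin_pos:
  fixes a :: real
  assumes "-pi/2 < a" "a < pi/2"
  shows "0 < cos a + a * sin a"
proof -
  have "0 \<le> a * sin a"
  proof (cases "0 \<le> a")
    case True
    then show ?thesis using assms by (intro mult_nonneg_nonneg sin_ge_zero) auto
  next
    case False
    then have "0 \<le> sin (-a)" using assms by (intro sin_ge_zero) auto
    then show ?thesis using False by (intro mult_nonpos_nonpos) auto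
  qed
  moreover have "0 < cos a" using assms by (intro cos_gt_zero_pi) auto
  ultimately show ?thesis by linarith
qed

lemma has_real_derivative_cyc_slope:
  assumes "cos a \<noteq> 0"
  shows "(cyc_slope has_real_derivative 2 * (cos a + a * sin a) / (cos a)^3) (at a)"
proof -
  have 1: "((\<lambda>a. a / (cos a)\<^sup>2) has_real_derivative
      ((cos a)\<^sup>2 + 2 * a * cos a * sin a) / ((cos a)\<^sup>2 * (cos a)\<^sup>2)) (at a)"
    using assms by (auto intro!: derivative_eq_intros)
  have "((cos a)\<^sup>2 + 2 * a * cos a * sin a) / ((cos a)\<^sup>2 * (cos a)\<^sup>2) + inverse ((cos a)\<^sup>2)
      = 2 * (cos a + a * sin a) / (cos a)^3"
  proof -
    have "(C\<^sup>2 + 2 * a * C * S) / (C\<^sup>2 * C\<^sup>2) = (C + 2 * a * S) / C^3" "inverse (C\<^sup>2) = C / C^3"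
      if "C \<noteq> 0" for C S :: real
      using that by (simp_all add: power2_eq_square power3_eq_cube divide_simps) (simp add: algebra_simps)
    then show ?thesis using assms by (simp add: add_divide_distrib[symmetric])
  qed
  then show ?thesis
    using DERIV_add[OF 1 DERIV_tan[OF assms]] unfolding cyc_slope_def by simp
qed

lemma cyc_slope_strict_mono: "strict_mono_on {-pi/2<..<pi/2} cyc_slope"
proof (rule strict_mono_onI)
  fix r s :: real
  assume rs: "r \<in> {-pi/2<..<pi/2}" "s \<in> {-pi/2<..<pi/2}" "r < s"
  show "cyc_slope r < cyc_slope s"
  proof (rule DERIV_pos_imp_increasing[OF rs(3)])
    fix x assume x: "r \<le> x" "x \<le> s"
    have c: "0 < cos x" using x rs by (intro cos_gt_zero_pi) auto
    have "0 < 2 * (cos x + x * sin x) / (cos x)^3"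
      using c cos_add_mult_sin_pos[of x] x rs by auto
    then show "\<exists>y. (cyc_slope has_real_derivative y) (at x) \<and> 0 < y"
      using has_real_derivative_cyc_slope[of x] c less_imp_neq by fastforce
  qed
qed

lemma cyc_slope_minus: "cyc_slope (- a) = - cyc_slope a"
  by (simp add: cyc_slope_def)

lemma cyc_slope_surj: "\<exists>a \<in> {-pi/2<..<pi/2}. cyc_slope a = u"
proof -
  \<comment> \<open>At \<open>b\<close> the tangent alone already equals the absolute value of
    \<open>u\<close>, and the other summand is nonnegative; oddness takes care of the left end
    \<open>-b\<close>.\<close>
  define b where "b = arctan \<bar>u\<bar>"
  have b: "0 \<le> b" "b < pi/2" unfolding b_def using arctan_ubound[of "\<bar>u\<bar>"] by auto
  have up: "\<bar>u\<bar> \<le> cyc_slope b"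
    using b by (simp add: cyc_slope_def b_def tan_arctan)
  have "\<exists>x\<ge>-b. x \<le> b \<and> cyc_slope x = u"
  proof (rule IVT)
    show "\<forall>x. - b \<le> x \<and> x \<le> b \<longrightarrow> isCont cyc_slope x"
    proof safe
      fix x assume "- b \<le> x" "x \<le> b"
      then have "cos x > 0" using b by (intro cos_gt_zero_pi) auto
      then show "isCont cyc_slope x"
        using has_real_derivative_cyc_slope[of x, THEN DERIV_isCont] by simp
    qed
  qed (use up b in \<open>auto simp: cyc_slope_minus\<close>)
  then show ?thesis using b by force
qed

lemma cyc_angle:
  shows cyc_angle_gt: "-pi/2 < cyc_angle u" and cyc_angle_less: "cyc_angle u < pi/2"
    and cyc_slope_cyc_angle: "cyc_slope (cyc_angle u) = u"
proof -
  have u: "u \<in> cyc_slope ` {-pi/2<..<pi/2}" using cyc_slope_surj[of u] by blast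
  show "-pi/2 < cyc_angle u" "cyc_angle u < pi/2"
    using inv_into_into[OF u] by (auto simp: cyc_angle_def)
  show "cyc_slope (cyc_angle u) = u"
    unfolding cyc_angle_def by (rule f_inv_into_f[OF u])
qed

lemma cos_cyc_angle_pos: "0 < cos (cyc_angle u)"
  using cyc_angle_gt[of u] cyc_angle_less[of u] by (intro cos_gt_zero_pi) auto

lemma cyc_angle_cyc_slope:
  assumes "-pi/2 < a" "a < pi/2"
  shows "cyc_angle (cyc_slope a) = a"
  unfolding cyc_angle_def
  by (rule inv_into_f_f[OF strict_mono_on_imp_inj_on[OF cyc_slope_strict_mono]]) (use assms in auto)

lemma has_real_derivative_cyc_angle:
  "(cyc_angle has_real_derivative
     (cos (cyc_angle u))^3 / (2 * (cos (cyc_angle u) + cyc_angle u * sin (cyc_angle u)))) (at u)"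
proof -
  define a where "a = cyc_angle u"
  have a: "-pi/2 < a" "a < pi/2" "cyc_slope a = u" "0 < cos a"
    using cyc_angle[of u] cos_cyc_angle_pos[of u] by (auto simp: a_def)
  \<comment> \<open>Half the distance to the nearer end, so that the closed
    \<open>d\<close>-neighbourhood of \<open>a\<close> stays inside the interval.\<close>
  define d where "d = min (a + pi/2) (pi/2 - a) / 2"
  have d: "0 < d" "d < a + pi/2" "d < pi/2 - a" using a by (auto simp: d_def min_def)
  have near: "-pi/2 < z \<and> z < pi/2" if "\<bar>z - a\<bar> \<le> d" for z
    using that d by (auto simp: abs_le_iff)
  have "isCont cyc_angle (cyc_slope a)"
  proof (rule isCont_inverse_function[where f = cyc_slope, OF d(1)])
    fix z assume "\<bar>z - a\<bar> \<le> d"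
    note z = near[OF this]
    show "cyc_angle (cyc_slope z) = z" using z cyc_angle_cyc_slope by blast
    have "0 < cos z" using z by (intro cos_gt_zero_pi) auto
    then show "isCont cyc_slope z"
      using has_real_derivative_cyc_slope[of z, THEN DERIV_isCont] by simp
  qed
  then have cont: "isCont cyc_angle u" by (simp add: a)
  have "(cyc_angle has_real_derivative inverse (2 * (cos a + a * sin a) / (cos a)^3)) (at u)"
  proof (rule DERIV_inverse_function[where f = cyc_slope and a = "u - 1" and b = "u + 1"])
    show "(cyc_slope has_real_derivative 2 * (cos a + a * sin a) / (cos a)^3) (at (cyc_angle u))"
      using has_real_derivative_cyc_slope[of a] a by (simp add: a_def)
  qed (use a cont cos_add_mult_sin_pos[of a] cyc_slope_cyc_angle in auto)
  then show ?thesis by (simp add: a_def)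
qed

text \<open>Length of the arc from height 1 to a vertex at signed distance \<open>u\<close>: with
  \<open>a = cyc_angle u\<close>, the rolling radius is \<open>1 / (2 * (cos a)^2)\<close> and the
  rolling angle is \<open>2 * a\<close>.\<close>

definition cyc_length :: "real \<Rightarrow> real" where
  "cyc_length u = 2 * cyc_angle u / cos (cyc_angle u)"

text \<open>The factor \<open>cos a + a * sin a\<close> cancels in the chain rule. Up to sign and
  scale, the remaining cosine is the horizontal part of the gradient of the calibration.\<close>

lemma has_real_derivative_cyc_length:
  "(cyc_length has_real_derivative cos (cyc_angle u)) (at u)"
proof -
  define a where "a = cyc_angle u"
  have c: "0 < cos a" "0 < cos a + a * sin a"
    using cos_cyc_angle_pos[of u] cos_add_mult_sin_pos[of a] cyc_angle[of u] by (auto simp: a_def)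
  have "((\<lambda>b. 2 * b / cos b) has_real_derivative 2 * (cos a + a * sin a) / (cos a)^2) (at (cyc_angle u))"
    unfolding a_def[symmetric] using c
    by (auto intro!: derivative_eq_intros simp: field_simps power2_eq_square)
  from DERIV_chain2[OF this has_real_derivative_cyc_angle]
  have "(cyc_length has_real_derivative
      2 * (cos a + a * sin a) / (cos a)^2 * ((cos a)^3 / (2 * (cos a + a * sin a)))) (at u)"
    unfolding cyc_length_def a_def .
  also have "2 * (cos a + a * sin a) / (cos a)^2 * ((cos a)^3 / (2 * (cos a + a * sin a))) = cos a"
  proof -
    have "2 * M / C\<^sup>2 * (C^3 / (2 * M)) = C" if "0 < M" "0 < C" for M C :: real
      using that by (simp add: power2_eq_square power3_eq_cube)
    then show ?thesis using c by blast
  qed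
  finally show ?thesis by (simp add: a_def)
qed

text \<open>By homogeneity, this identity is what makes the calibration below satisfy the eikonal equation.\<close>

lemma cyc_length_eq: "cyc_length u / 2 - u * cos (cyc_angle u) = - sin (cyc_angle u)"
proof -
  define a where "a = cyc_angle u"
  have "0 < cos a" using cos_cyc_angle_pos[of u] by (simp add: a_def)
  moreover have "u = a / (cos a)\<^sup>2 + tan a"
    using cyc_slope_cyc_angle[of u] by (simp add: a_def cyc_slope_def)
  ultimately show ?thesis
    unfolding cyc_length_def a_def[symmetric]
    by (simp add: field_simps power2_eq_square tan_def)
qed

lemma cyc_angle_0: "cyc_angle 0 = 0"
  using cyc_angle_cyc_slope[of 0] by (simp add: cyc_slope_def)

lemma cyc_length_0: "cyc_length 0 = 0"
  by (simp add: cyc_length_def cyc_angle_0)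

lemma cyc_angle_pos:
  assumes "0 < u"
  shows "0 < cyc_angle u"
proof (rule ccontr)
  assume "\<not> 0 < cyc_angle u"
  then have "cyc_slope (cyc_angle u) \<le> cyc_slope 0"
    using cyc_angle_gt[of u] cyc_angle_less[of u]
    by (intro strict_mono_on_leD[OF cyc_slope_strict_mono]) auto
  then show False using assms by (simp add: cyc_slope_cyc_angle cyc_slope_def[of 0])
qed

section \<open>The function psi\<close>

lemma psi_strict_mono: "strict_mono_on {0<..<2*pi} psi"
proof (rule strict_mono_onI)
  fix r s :: real
  assume rs: "r \<in> {0<..<2*pi}" "s \<in> {0<..<2*pi}" "r < s"
  show "psi r < psi s"
  proof (rule DERIV_pos_imp_increasing[OF rs(3)])
    fix x assume x: "r \<le> x" "x \<le> s"
    have c: "cos x < 1" using x rs by (intro cos_less_one) auto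
    have "(psi has_real_derivative (2 * (1 - cos x) - x * sin x) / (1 - cos x)\<^sup>2) (at x)"
      unfolding psi_def using c
      apply (auto intro!: derivative_eq_intros)
      using sin_cos_squared_add3[of x] by (simp add: field_simps power2_eq_square)
    moreover have "0 < (2 * (1 - cos x) - x * sin x) / (1 - cos x)\<^sup>2"
      using c mult_sin_less_versine[of x] x rs by auto
    ultimately show "\<exists>y. (psi has_real_derivative y) (at x) \<and> 0 < y" by blast
  qed
qed

text \<open>This makes the optimal rolling angle admissible. With \<open>a = cyc_angle u\<close>,
  cross-multiplication reduces it to \<open>a * cos (2*a) \<le> sin a * cos a\<close>, which is
  \<open>mult_cos_less_sin\<close> at \<open>2*a\<close>.\<close>

lemma psi_double_cyc_angle_le:
  assumes "0 < u"
  shows "psi (2 * cyc_angle u) \<le> u"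
proof -
  define a where "a = cyc_angle u"
  have a: "0 < a" "a < pi/2" "0 < cos a" and u: "u = a / (cos a)\<^sup>2 + tan a"
    using cyc_angle_pos[OF assms] cyc_angle[of u] cos_cyc_angle_pos[of u]
    by (auto simp: a_def cyc_slope_def)
  have s: "0 < sin a" using a by (intro sin_gt_zero) auto
  have "(2*a) * cos (2*a) \<le> sin (2*a)"
    using a by (intro less_imp_le mult_cos_less_sin) auto
  then have *: "a * ((cos a)\<^sup>2 - (sin a)\<^sup>2) \<le> sin a * cos a"
    by (simp add: cos_double sin_double)
  have "psi (2 * a) = (2 * (a - sin a * cos a)) / (2 * (sin a)\<^sup>2)"
    unfolding psi_def cos_double_sin sin_double by (simp add: right_diff_distrib mult.assoc)
  also have "\<dots> = (a - sin a * cos a) / (sin a)\<^sup>2" by (rule mult_divide_mult_cancel_left) simp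
  also have "\<dots> \<le> (a + sin a * cos a) / (cos a)\<^sup>2"
  proof -
    have "(a + sin a * cos a) * (sin a)\<^sup>2 - (a - sin a * cos a) * (cos a)\<^sup>2
        = sin a * cos a * ((sin a)\<^sup>2 + (cos a)\<^sup>2) - a * ((cos a)\<^sup>2 - (sin a)\<^sup>2)"
      by algebra
    then have "(a - sin a * cos a) * (cos a)\<^sup>2 \<le> (a + sin a * cos a) * (sin a)\<^sup>2"
      using * unfolding sin_cos_squared_add by linarith
    then show ?thesis using s a by (simp add: divide_le_eq pos_le_divide_eq mult.commute)
  qed
  also have "\<dots> = u"
    using a by (simp add: u tan_def field_simps power2_eq_square)
  finally show ?thesis by (simp add: a_def)
qed

lemma psi_inv:
  assumes "0 < b"
  shows psi_inv_in: "psi_inv b \<in> {0<..<2*pi}" and psi_psi_inv: "psi (psi_inv b) = b"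
proof -
  \<comment> \<open>The ends \<open>a\<close> and \<open>c\<close> bracket the value
    \<open>b\<close> for the intermediate value theorem. The shift by \<open>pi\<close> in
    \<open>c\<close> turns \<open>1 - cos c\<close> into \<open>2 * (cos z)^2\<close> with
    \<open>z = arctan b\<close>, so that \<open>psi c\<close> is at least
    \<open>tan z\<close>.\<close>
  define a where "a = 2 * cyc_angle b"
  define c where "c = pi + 2 * arctan b"
  have a: "0 < a" "a < pi" using cyc_angle_pos[OF assms] cyc_angle_less[of b] by (auto simp: a_def)
  have c: "pi < c" "c < 2 * pi" using assms arctan_ubound[of b] by (auto simp: c_def)
  have lo: "psi a \<le> b" unfolding a_def by (rule psi_double_cyc_angle_le[OF assms])
  have hi: "b \<le> psi c"
  proof -
    define z where "z = arctan b"
    have z: "0 < z" "0 < cos z" "tan z = b" "z < pi/2"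
      using assms arctan_ubound[of b] arctan_lbound[of b]
      by (auto simp: z_def tan_arctan intro!: cos_gt_zero_pi)
    have "psi c = (pi + 2 * z + 2 * sin z * cos z) / (2 * (cos z)\<^sup>2)"
      by (simp add: psi_def c_def z_def[symmetric] sin_add cos_add sin_double cos_double_cos)
    also have "\<dots> \<ge> (2 * sin z * cos z) / (2 * (cos z)\<^sup>2)"
      using z by (intro divide_right_mono) auto
    also have "(2 * sin z * cos z) / (2 * (cos z)\<^sup>2) = tan z"
      using z by (simp add: tan_def power2_eq_square)
    finally show ?thesis using z by simp
  qed
  have "\<exists>x\<ge>a. x \<le> c \<and> psi x = b"
  proof (rule IVT[where f = psi and a = a and b = c, OF lo hi])
    show "\<forall>x. a \<le> x \<and> x \<le> c \<longrightarrow> isCont psi x"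
    proof safe
      fix x assume "a \<le> x" "x \<le> c"
      then have "cos x < 1" using a c by (intro cos_less_one) auto
      then show "isCont psi x" unfolding psi_def by (auto intro!: continuous_intros)
    qed
  qed (use a c in auto)
  then obtain x where "a \<le> x" "x \<le> c" "psi x = b" by blast
  then have x: "x \<in> {0<..<2*pi}" "psi x = b" using a c by auto
  have "psi_inv b = x" unfolding psi_inv_def
  proof (rule the_equality)
    fix y assume "y \<in> {0<..<2*pi} \<and> psi y = b"
    then show "y = x"
      using x strict_mono_on_imp_inj_on[OF psi_strict_mono] by (auto dest: inj_onD)
  qed (use x in auto)
  then show "psi_inv b \<in> {0<..<2*pi}" "psi (psi_inv b) = b" using x by auto
qed

lemma le_psi_inv_iff:
  assumes "0 < b" "x \<in> {0<..<2*pi}"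
  shows "x \<le> psi_inv b \<longleftrightarrow> psi x \<le> b"
  using strict_mono_on_leD[OF psi_strict_mono, of x "psi_inv b"]
    strict_mono_onD[OF psi_strict_mono, of "psi_inv b" x] psi_inv[OF assms(1)] assms(2)
  by (metis linorder_not_le)

section \<open>Lengths of paths\<close>

text \<open>The fundamental theorem of calculus yields a gauge integral, whereas
  \<open>hlength\<close> is a Lebesgue integral. If the right side is finite, \<open>k\<close> is
  Lebesgue integrable on \<open>A\<close> and the two integrals agree; otherwise the bound is
  trivial.\<close>

lemma has_integral_abs_le_nn_integral:
  fixes k :: "real \<Rightarrow> real"
  assumes "(k has_integral I) A"
  shows "ennreal \<bar>I\<bar> \<le> (\<integral>\<^sup>+ t. indicator A t * ennreal \<bar>k t\<bar> \<partial>lborel)"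
proof -
  define f where "f = (\<lambda>t. k t * indicator A t)"
  have m: "f \<in> borel_measurable lebesgue"
    unfolding f_def using assms by (rule has_integral_implies_lebesgue_measurable_real)
  have eq: "(\<integral>\<^sup>+ t. indicator A t * ennreal \<bar>k t\<bar> \<partial>lborel) = (\<integral>\<^sup>+ t. ennreal (norm (f t)) \<partial>lebesgue)"
    unfolding nn_integral_completion
    by (intro nn_integral_cong) (auto simp: f_def indicator_def)
  show ?thesis
  proof (cases "(\<integral>\<^sup>+ t. ennreal (norm (f t)) \<partial>lebesgue) < \<infinity>")
    case True
    then have int: "integrable lebesgue f" using m by (intro integrableI_bounded)
    then have set: "set_integrable lebesgue A k"
      unfolding set_integrable_def f_def by (simp add: mult.commute)
    have "integral\<^sup>L lebesgue f = I"
      using set_lebesgue_integral_eq_integral(2)[OF set] integral_unique[OF assms]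
      unfolding set_lebesgue_integral_def f_def by (simp add: mult.commute)
    then show ?thesis using integral_norm_bound_ennreal[OF int] unfolding eq by simp
  next
    case False
    then show ?thesis unfolding eq by (simp add: less_top[symmetric])
  qed
qed

lemma abs_diff_le_hlength:
  assumes "finite S" and cont: "continuous_on {0..1} \<phi>"
    and der: "\<And>t. t \<in> {0<..<1} - S \<Longrightarrow> (\<phi> has_real_derivative k t) (at t)"
    and le: "\<And>t. t \<in> {0<..<1} - S \<Longrightarrow> ennreal \<bar>k t\<bar> \<le> hspeed (g t) (vector_derivative g (at t))"
  shows "ennreal \<bar>\<phi> 1 - \<phi> 0\<bar> \<le> hlength g"
proof -
  have "(k has_integral (\<phi> 1 - \<phi> 0)) {0..1}"
    by (rule fundamental_theorem_of_calculus_interior_strong[OF assms(1) _ _ cont])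
      (use der in \<open>auto simp: has_real_derivative_iff_has_vector_derivative\<close>)
  from has_integral_abs_le_nn_integral[OF this]
  have "ennreal \<bar>\<phi> 1 - \<phi> 0\<bar> \<le> (\<integral>\<^sup>+ t. indicator {0..1} t * ennreal \<bar>k t\<bar> \<partial>lborel)" .
  also have "\<dots> \<le> hlength g"
    unfolding hlength_def
  proof (rule nn_integral_mono_AE)
    \<comment> \<open>The hypotheses concern only interior points outside \<open>S\<close>; the
      other points of the interval form a finite set.\<close>
    have "AE t in lborel. t \<notin> S \<union> {0, 1}"
      using assms(1) by (intro AE_not_in finite_imp_null_set_lborel) auto
    then show "AE t in lborel. indicator {0..1} t * ennreal \<bar>k t\<bar>
        \<le> indicator {0..1} t * hspeed (g t) (vector_derivative g (at t))"
    proof eventually_elim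
      case (elim t)
      then show ?case using le[of t] by (cases "t \<in> {0..1}") auto
    qed
  qed
  finally show ?thesis .
qed

text \<open>
  The calibration \<open>T (x, w) = sqrt w * cyc_length ((\<beta> - x) / w)\<close> is the signed distance to the line
  \<open>x = \<beta>\<close>, and its gradient has Euclidean norm \<open>1 / sqrt w\<close>. Evaluating it at the height \<open>w = v + e\<close>
  keeps it differentiable along paths that touch the boundary.
\<close>

lemma has_real_derivative_calibration:
  fixes x v :: "real \<Rightarrow> real" and \<beta> :: real
  assumes "(x has_real_derivative x') (at t)" "(v has_real_derivative v') (at t)" "0 < v t + e"
  defines "a \<equiv> cyc_angle ((\<beta> - x t) / (v t + e))"
  shows "((\<lambda>t. sqrt (v t + e) * cyc_length ((\<beta> - x t) / (v t + e))) has_real_derivative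
      - (cos a * x' + sin a * v') / sqrt (v t + e)) (at t)"
proof -
  define w where "w = v t + e"
  define u where "u = (\<beta> - x t) / w"
  define q where "q = sqrt w"
  have q: "0 < q" "w = q * q" using assms(3) by (auto simp: q_def w_def)
  have a: "a = cyc_angle u" by (simp add: a_def u_def w_def)
  have y: "\<beta> - x t = u * w" using q by (simp add: u_def)
  have du: "((\<lambda>t. (\<beta> - x t) / (v t + e)) has_real_derivative (- x' * w - u * w * v') / (w * w)) (at t)"
    unfolding y[symmetric] using assms(1-3) by (auto intro!: derivative_eq_intros simp: w_def)
  have dq: "((\<lambda>t. sqrt (v t + e)) has_real_derivative v' / (2 * q)) (at t)"
    using assms(2,3) by (auto intro!: derivative_eq_intros simp: q_def w_def field_simps)
  have dl: "((\<lambda>t. cyc_length ((\<beta> - x t) / (v t + e))) has_real_derivative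
      cos a * ((- x' * w - u * w * v') / (w * w))) (at t)"
    using DERIV_chain2[OF has_real_derivative_cyc_length du] by (simp add: a_def)
  \<comment> \<open>By \<open>cyc_length_eq\<close> the coefficient of \<open>v'\<close> collapses
    to \<open>- sin a\<close>, so the gradient is a unit vector divided by \<open>q\<close>.\<close>
  have "v' / (2 * q) * cyc_length u + cos a * ((- x' * w - u * w * v') / (w * w)) * q
      = (v' * (cyc_length u / 2 - u * cos a) - cos a * x') / q"
    using q(1) unfolding q(2) by (simp add: field_simps)
  also have "\<dots> = - (cos a * x' + sin a * v') / q"
    unfolding a cyc_length_eq by (simp add: algebra_simps)
  finally show ?thesis
    using DERIV_mult[OF dq dl] by (simp add: u_def w_def q_def)
qed

text \<open>Cauchy-Schwarz against a unit vector; the defect is the square of the other rotated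
  coordinate.\<close>

lemma abs_cos_sin_le_norm: "\<bar>cos a * x + sin a * y\<bar> \<le> norm (x, y)"
proof -
  have "(cos a * x + sin a * y)\<^sup>2 + (sin a * x - cos a * y)\<^sup>2
      = ((sin a)\<^sup>2 + (cos a)\<^sup>2) * (x\<^sup>2 + y\<^sup>2)"
    unfolding power2_eq_square by algebra
  then have "(cos a * x + sin a * y)\<^sup>2 \<le> x\<^sup>2 + y\<^sup>2"
    using zero_le_power2[of "sin a * x - cos a * y"]
    by (simp only: sin_cos_squared_add mult_1_left)
  then show ?thesis by (simp add: norm_Pair real_le_rsqrt)
qed

text \<open>Raising the height by \<open>e\<close> only lowers the speed. On the boundary
  \<open>hspeed\<close> is infinite unless \<open>w = 0\<close>, and then \<open>k = 0\<close>
  too.\<close>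

lemma le_hspeed:
  assumes "0 \<le> snd p" "0 < e" "\<bar>k\<bar> \<le> norm w"
  shows "ennreal \<bar>k / sqrt (snd p + e)\<bar> \<le> hspeed p w"
proof (cases "0 < snd p")
  case True
  have "\<bar>k / sqrt (snd p + e)\<bar> \<le> norm w / sqrt (snd p)"
    using assms True by (auto simp: abs_divide intro!: frac_le)
  also have "\<dots> = sqrt ((norm w)\<^sup>2 / snd p)" by (simp add: real_sqrt_divide)
  finally show ?thesis using True by (simp add: hspeed_def)
next
  case False
  then show ?thesis using assms by (auto simp: hspeed_def)
qed

text \<open>The raised calibration vanishes at the end of the path, on the line, and changes no
  faster than length accumulates. Hence its initial value bounds the length, and \<open>e\<close>
  tends to 0 from the right.\<close>

lemma cyc_length_le_hlength:
  assumes g: "g \<in> hpaths (0, 1) (\<beta>, v1)"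
  shows "ennreal (cyc_length \<beta>) \<le> hlength g"
proof -
  obtain S D where S: "finite S" and cont: "continuous_on {0..1} g"
    and D: "\<And>t. t \<in> {0..1} - S \<Longrightarrow> (g has_vector_derivative D t) (at t)"
    using g unfolding hpaths_def piecewise_C1_differentiable_on_def C1_differentiable_on_def by blast
  have pos: "0 \<le> snd (g t)" if "t \<in> {0..1}" for t
    using g that unfolding hpaths_def Hplane_def by blast
  have ends: "g 0 = (0, 1)" "g 1 = (\<beta>, v1)" using g by (auto simp: hpaths_def)
  have bound: "ennreal (sqrt (1 + e) * cyc_length (\<beta> / (1 + e))) \<le> hlength g" if e: "0 < e" for e
  proof -
    define \<phi> where "\<phi> = (\<lambda>t. sqrt (snd (g t) + e) * cyc_length ((\<beta> - fst (g t)) / (snd (g t) + e)))"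
    define a where "a = (\<lambda>t. cyc_angle ((\<beta> - fst (g t)) / (snd (g t) + e)))"
    have "continuous_on UNIV cyc_length"
      using has_real_derivative_cyc_length DERIV_isCont by (auto intro!: continuous_at_imp_continuous_on)
    moreover have "continuous_on {0..1} (\<lambda>t. (\<beta> - fst (g t)) / (snd (g t) + e))"
    proof (intro continuous_intros cont ballI)
      fix t :: real assume "t \<in> {0..1}"
      then show "snd (g t) + e \<noteq> 0" using pos[of t] e by linarith
    qed
    ultimately have "continuous_on {0..1} (\<lambda>t. cyc_length ((\<beta> - fst (g t)) / (snd (g t) + e)))"
      by (rule continuous_on_compose2) simp
    then have "continuous_on {0..1} \<phi>"
      unfolding \<phi>_def by (intro continuous_intros cont)
    then have "ennreal \<bar>\<phi> 1 - \<phi> 0\<bar> \<le> hlength g"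
    proof (rule abs_diff_le_hlength[OF S])
      fix t assume t: "t \<in> {0<..<1} - S"
      then have Dt: "(g has_vector_derivative D t) (at t)" and pt: "0 \<le> snd (g t)"
        using D pos by auto
      have "((\<lambda>t. fst (g t)) has_real_derivative fst (D t)) (at t)"
        "((\<lambda>t. snd (g t)) has_real_derivative snd (D t)) (at t)"
        using bounded_linear.has_vector_derivative[OF bounded_linear_fst Dt]
          bounded_linear.has_vector_derivative[OF bounded_linear_snd Dt]
        by (simp_all add: has_real_derivative_iff_has_vector_derivative)
      from has_real_derivative_calibration[OF this, of e \<beta>] pt e
      show "(\<phi> has_real_derivative
          - (cos (a t) * fst (D t) + sin (a t) * snd (D t)) / sqrt (snd (g t) + e)) (at t)"
        by (simp add: \<phi>_def a_def)
      show "ennreal \<bar>- (cos (a t) * fst (D t) + sin (a t) * snd (D t)) / sqrt (snd (g t) + e)\<bar>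
          \<le> hspeed (g t) (vector_derivative g (at t))"
        unfolding vector_derivative_at[OF Dt]
        by (rule le_hspeed[OF pt e])
          (metis abs_minus_cancel abs_cos_sin_le_norm prod.collapse)
    qed
    moreover have "\<phi> 1 = 0" by (simp add: \<phi>_def ends cyc_length_0)
    moreover have "\<phi> 0 = sqrt (1 + e) * cyc_length (\<beta> / (1 + e))" by (simp add: \<phi>_def ends)
    ultimately have "ennreal \<bar>sqrt (1 + e) * cyc_length (\<beta> / (1 + e))\<bar> \<le> hlength g" by simp
    then show ?thesis by (rule order_trans[rotated]) (rule ennreal_leI[OF abs_ge_self])
  qed
  have "((\<lambda>e. ennreal (sqrt (1 + e) * cyc_length (\<beta> / (1 + e)))) \<longlongrightarrow>
      ennreal (sqrt (1 + 0) * cyc_length (\<beta> / (1 + 0)))) (at_right 0)"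
    using has_real_derivative_cyc_length[of \<beta>, THEN DERIV_isCont]
    by (intro tendsto_ennrealI tendsto_mult isCont_tendsto_compose[where g = cyc_length] tendsto_intros)
      auto
  then have "ennreal (sqrt (1 + 0) * cyc_length (\<beta> / (1 + 0))) \<le> hlength g"
    by (rule tendsto_upperbound) (auto intro!: bound eventually_at_right_less[THEN eventually_mono])
  then show ?thesis by simp
qed

section \<open>Lengths of explicit paths and finiteness of the distance\<close>

lemma C1_path_hlength_le:
  fixes x v x' v' :: "real \<Rightarrow> real"
  assumes der: "\<And>t. (x has_real_derivative x' t) (at t)" "\<And>t. (v has_real_derivative v' t) (at t)"
    and cont: "continuous_on UNIV x'" "continuous_on UNIV v'"
    and pos: "\<And>t. 0 \<le> v t" and K: "0 \<le> K"
    and le: "\<And>t. (x' t)\<^sup>2 + (v' t)\<^sup>2 \<le> K\<^sup>2 * v t"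
  shows "(\<lambda>t. (x t, v t)) \<in> hpaths (x 0, v 0) (x 1, v 1)"
    and "hlength (\<lambda>t. (x t, v t)) \<le> ennreal K"
proof -
  have D: "((\<lambda>t. (x t, v t)) has_vector_derivative (x' t, v' t)) (at t)" for t
    using der by (intro has_vector_derivative_Pair)
      (simp_all add: has_real_derivative_iff_has_vector_derivative)
  have "continuous_on UNIV (\<lambda>t. (x' t, v' t))" using cont by (intro continuous_intros)
  then have "(\<lambda>t. (x t, v t)) C1_differentiable_on {0..1}"
    unfolding C1_differentiable_on_def using D
    by (intro exI[of _ "\<lambda>t. (x' t, v' t)"]) (auto intro: continuous_on_subset)
  then show "(\<lambda>t. (x t, v t)) \<in> hpaths (x 0, v 0) (x 1, v 1)"
    using pos by (auto simp: hpaths_def Hplane_def intro: C1_differentiable_imp_piecewise)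
  have speed: "hspeed (x t, v t) (x' t, v' t) \<le> ennreal K" for t
  proof (cases "0 < v t")
    case True
    have "sqrt (((x' t)\<^sup>2 + (v' t)\<^sup>2) / v t) \<le> sqrt (K\<^sup>2)"
      using le[of t] True by (intro real_sqrt_le_mono) (simp add: divide_le_eq)
    then show ?thesis using True K by (simp add: hspeed_def norm_Pair ennreal_leI)
  next
    case False
    then have "v t = 0" using pos[of t] by simp
    \<comment> \<open>The speed bound, with the height multiplied out, forces the velocity to vanish
      on the boundary, where \<open>hspeed\<close> is then 0.\<close>
    then have "(x' t)\<^sup>2 + (v' t)\<^sup>2 \<le> 0" using le[of t] by simp
    then have "x' t = 0 \<and> v' t = 0" using sum_power2_le_zero_iff by blast
    then show ?thesis using \<open>v t = 0\<close> by (simp add: hspeed_def zero_prod_def)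
  qed
  have "hlength (\<lambda>t. (x t, v t)) \<le> (\<integral>\<^sup>+ t. ennreal K * indicator {0..1::real} t \<partial>lborel)"
    unfolding hlength_def vector_derivative_at[OF D]
    using speed by (intro nn_integral_mono) (auto simp: indicator_def)
  also have "\<dots> = ennreal K" by (subst nn_integral_cmult_indicator) auto
  finally show "hlength (\<lambda>t. (x t, v t)) \<le> ennreal K" .
qed

text \<open>Since \<open>enn2real\<close> sends infinity to 0, a lower bound on lengths passes to
  \<open>dH\<close> only if the infimum is finite.\<close>

lemma dH_finite:
  assumes "0 \<le> v1"
  shows "(INF g\<in>hpaths (0, 1) (\<beta>, v1). hlength g) < \<infinity>"
proof -
  define s where "s = sqrt v1"
  \<comment> \<open>The horizontal displacement below is \<open>c\<close> times the mean of 1 and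
    \<open>s\<close>, which has to equal \<open>\<beta>\<close>.\<close>
  define c where "c = 2 * \<beta> / (1 + s)"
  define K where "K = sqrt (c\<^sup>2 + (2 * (s - 1))\<^sup>2)"
  \<comment> \<open>Both velocity components are proportional to the square root of the height, so the speed is constant.\<close>
  define x where "x = (\<lambda>t::real. c * (t + (s - 1) * t\<^sup>2 / 2))"
  define v where "v = (\<lambda>t. (1 + (s - 1) * t)\<^sup>2)"
  have s: "0 \<le> s" "s\<^sup>2 = v1" using assms by (auto simp: s_def)
  have K2: "K\<^sup>2 = c\<^sup>2 + (2 * (s - 1))\<^sup>2" by (simp add: K_def)
  have dx: "(x has_real_derivative c * (1 + (s - 1) * t)) (at t)" for t
    unfolding x_def by (auto intro!: derivative_eq_intros simp: field_simps)
  have dv: "(v has_real_derivative 2 * (s - 1) * (1 + (s - 1) * t)) (at t)" for t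
    unfolding v_def by (auto intro!: derivative_eq_intros simp: algebra_simps)
  have path: "(\<lambda>t. (x t, v t)) \<in> hpaths (x 0, v 0) (x 1, v 1)"
    and len: "hlength (\<lambda>t. (x t, v t)) \<le> ennreal K"
  proof -
    have cont: "continuous_on UNIV (\<lambda>t. c * (1 + (s - 1) * t))"
      "continuous_on UNIV (\<lambda>t. 2 * (s - 1) * (1 + (s - 1) * t))"
      by (intro continuous_intros)+
    have pos: "0 \<le> v t" for t by (simp add: v_def)
    have le: "(c * (1 + (s - 1) * t))\<^sup>2 + (2 * (s - 1) * (1 + (s - 1) * t))\<^sup>2 \<le> K\<^sup>2 * v t" for t
      unfolding K2 v_def power_mult_distrib by (simp only: distrib_right order_refl)
    have "0 \<le> K" by (simp add: K_def)
    from C1_path_hlength_le[OF dx dv cont pos this le]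
    show "(\<lambda>t. (x t, v t)) \<in> hpaths (x 0, v 0) (x 1, v 1)" "hlength (\<lambda>t. (x t, v t)) \<le> ennreal K" .
  qed
  have "c + c * s = 2 * \<beta>" using s by (simp add: c_def divide_simps) (simp add: algebra_simps)
  then have "x 1 = \<beta>" by (simp add: x_def field_simps)
  then have "(\<lambda>t. (x t, v t)) \<in> hpaths (0, 1) (\<beta>, v1)"
    using path s by (simp add: x_def v_def)
  then have "(INF g\<in>hpaths (0, 1) (\<beta>, v1). hlength g) \<le> hlength (\<lambda>t. (x t, v t))"
    by (rule INF_lower)
  also have "\<dots> < \<infinity>" using len by (simp add: order_le_less_trans)
  finally show ?thesis .
qed

lemma cyc_length_le_dH:
  assumes "0 \<le> v1" "0 < \<beta>"
  shows "cyc_length \<beta> \<le> dH (0, 1) (\<beta>, v1)"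
proof -
  have "ennreal (cyc_length \<beta>) \<le> (INF g\<in>hpaths (0, 1) (\<beta>, v1). hlength g)"
    by (intro INF_greatest cyc_length_le_hlength)
  moreover have "0 \<le> cyc_length \<beta>"
    using cyc_angle_pos[OF assms(2)] cos_cyc_angle_pos[of \<beta>] by (simp add: cyc_length_def)
  ultimately show ?thesis
    unfolding dH_def using dH_finite[OF assms(1), of \<beta>]
    by (metis enn2real_ennreal enn2real_mono infinity_ennreal_def)
qed

lemma dH_le:
  assumes "g \<in> hpaths p q" "hlength g \<le> ennreal K" "0 \<le> K"
  shows "dH p q \<le> K"
proof -
  have "(INF g\<in>hpaths p q. hlength g) \<le> ennreal K"
    using INF_lower[OF assms(1), of hlength] assms(2) by order
  then show ?thesis
    unfolding dH_def using assms(3) enn2real_leI by blast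
qed

section \<open>The cycloid family and Lambda\<close>

text \<open>
  The cycloid through \<open>(0, 1)\<close> with rolling radius \<open>r = (1 + s\<^sup>2) / 2\<close> and initial slope \<open>s\<close>
  reaches the line \<open>x = \<beta>\<close> after the rolling angle \<open>\<theta>\<close> exactly when the quadratic equation
  for \<open>s\<close> below holds.
\<close>

lemma cycloid_dH_le:
  assumes "0 < \<theta>"
    and quad: "(\<theta> - sin \<theta>) * s\<^sup>2 / 2 + (1 - cos \<theta>) * s + (\<theta> + sin \<theta>) / 2 = \<beta>"
  obtains v1 where "0 \<le> v1" "dH (0, 1) (\<beta>, v1) \<le> \<theta> * sqrt (1 + s\<^sup>2)"
proof -
  define r where "r = (1 + s\<^sup>2) / 2"
  define v where "v = (\<lambda>t. r - (r - 1) * cos (\<theta> * t) + s * sin (\<theta> * t))"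
  define w where "w = (\<lambda>t. (r - 1) * sin (\<theta> * t) + s * cos (\<theta> * t))"
  define x where "x = (\<lambda>t. r * \<theta> * t - (r - 1) * sin (\<theta> * t) + s * (1 - cos (\<theta> * t)))"
  have r: "0 < r" "s\<^sup>2 = 2 * r - 1" by (auto simp: r_def add_pos_nonneg field_simps)
  \<comment> \<open>The point \<open>(v t, w t)\<close> stays on the circle of radius
    \<open>r\<close> about \<open>(r, 0)\<close>. This gives both nonnegative height and constant
    speed \<open>\<theta> * sqrt (2 * r)\<close>.\<close>
  have id: "(v t)\<^sup>2 + (w t)\<^sup>2 = 2 * r * v t" for t
  proof -
    have "(v t - r)\<^sup>2 + (w t)\<^sup>2 = ((r - 1)\<^sup>2 + s\<^sup>2) * ((sin (\<theta> * t))\<^sup>2 + (cos (\<theta> * t))\<^sup>2)"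
      unfolding v_def w_def power2_eq_square by algebra
    also have "\<dots> = r\<^sup>2" unfolding sin_cos_squared_add r(2) by (simp add: power2_eq_square algebra_simps)
    finally show ?thesis by (simp add: power2_eq_square algebra_simps)
  qed
  have pos: "0 \<le> v t" for t
  proof -
    have "0 \<le> 2 * r * v t" unfolding id[symmetric] by simp
    then show ?thesis using r by (simp add: zero_le_mult_iff)
  qed
  have dx: "(x has_real_derivative \<theta> * v t) (at t)" for t
    unfolding x_def v_def by (auto intro!: derivative_eq_intros simp: algebra_simps)
  have dv: "(v has_real_derivative \<theta> * w t) (at t)" for t
    unfolding v_def w_def by (auto intro!: derivative_eq_intros simp: algebra_simps)
  have K: "(\<theta> * v t)\<^sup>2 + (\<theta> * w t)\<^sup>2 \<le> (\<theta> * sqrt (1 + s\<^sup>2))\<^sup>2 * v t" for t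
  proof -
    have "(\<theta> * v t)\<^sup>2 + (\<theta> * w t)\<^sup>2 = \<theta>\<^sup>2 * ((v t)\<^sup>2 + (w t)\<^sup>2)"
      by (simp add: power_mult_distrib algebra_simps)
    then show ?thesis unfolding id by (simp add: power_mult_distrib r(2) less_imp_le[OF r(1)])
  qed
  have cont: "continuous_on UNIV (\<lambda>t. \<theta> * v t)" "continuous_on UNIV (\<lambda>t. \<theta> * w t)"
    unfolding v_def w_def by (intro continuous_intros)+
  have K0: "0 \<le> \<theta> * sqrt (1 + s\<^sup>2)" using assms(1) by simp
  note P = C1_path_hlength_le[OF dx dv cont pos K0 K]
  have "x 1 = \<beta>" using quad by (simp add: x_def r_def field_simps)
  then have "(\<lambda>t. (x t, v t)) \<in> hpaths (0, 1) (\<beta>, v 1)" using P(1) by (simp add: x_def v_def)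
  from dH_le[OF this P(2) K0] show ?thesis using that pos by blast
qed

text \<open>The radicand in \<open>Lambda\<close> is the square of \<open>B * s + A\<close>, with
  \<open>A\<close> and \<open>B\<close> as below. The assumption \<open>larger\<close> makes
  \<open>s\<close> the larger root, which matches the nonnegative square root.\<close>

lemma Lambda_eq:
  assumes "0 < \<theta>"
    and quad: "(\<theta> - sin \<theta>) * s\<^sup>2 / 2 + (1 - cos \<theta>) * s + (\<theta> + sin \<theta>) / 2 = \<beta>"
    and larger: "0 \<le> (\<theta> - sin \<theta>) * s + (1 - cos \<theta>)"
  shows "Lambda \<beta> \<theta> = (\<theta> * sqrt (1 + s\<^sup>2))\<^sup>2 / 2"
proof -
  define A where "A = 1 - cos \<theta>"
  define B where "B = \<theta> - sin \<theta>"
  have B: "0 < B" using sin_less_self[OF assms(1)] by (simp add: B_def)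
  \<comment> \<open>The Pythagorean identity in terms of \<open>A\<close> and \<open>B\<close>;
    after this the computation is purely algebraic.\<close>
  have sq: "(\<theta> - B)\<^sup>2 = 2 * A - A\<^sup>2"
    using sin_cos_squared_add[of \<theta>] by (simp add: A_def B_def power2_eq_square algebra_simps)
  have sin: "sin \<theta> = \<theta> - B" by (simp add: B_def)
  have \<beta>: "\<beta> = B * s\<^sup>2 / 2 + A * s + (2 * \<theta> - B) / 2"
    using quad by (simp add: A_def[symmetric] B_def[symmetric]) (simp add: B_def)
  have "2 * B * \<beta> + 2 * A - \<theta>\<^sup>2 = (B * s + A)\<^sup>2"
    using sq unfolding \<beta> by (simp add: power2_eq_square field_simps)
  then have root: "sqrt (2 * B * \<beta> + 2 * A - \<theta>\<^sup>2) = B * s + A"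
    using larger by (simp add: A_def B_def)
  have "Lambda \<beta> \<theta> = \<theta>\<^sup>2 / B\<^sup>2 * (B * \<beta> + 2 * A - \<theta> * (\<theta> - B) - A * (B * s + A))"
    unfolding Lambda_def A_def[symmetric] B_def[symmetric] root by (simp add: sin)
  also have "B * \<beta> + 2 * A - \<theta> * (\<theta> - B) - A * (B * s + A) = B\<^sup>2 * ((1 + s\<^sup>2) / 2)"
    using sq unfolding \<beta> by (simp add: power2_eq_square field_simps)
  also have "\<theta>\<^sup>2 / B\<^sup>2 * (B\<^sup>2 * ((1 + s\<^sup>2) / 2)) = \<theta>\<^sup>2 * (1 + s\<^sup>2) / 2"
    using B by simp
  finally show ?thesis by (simp add: power_mult_distrib)
qed

text \<open>The expression increases with \<open>\<beta>\<close>, so the case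
  \<open>\<beta> = psi \<theta> = B / A\<close> suffices. There, multiplied by \<open>A * A\<close>,
  it is a perfect square.\<close>

lemma discriminant_nonneg:
  assumes "0 < \<theta>" "\<theta> < 2 * pi" "psi \<theta> \<le> \<beta>"
  shows "0 \<le> 2 * (\<theta> - sin \<theta>) * \<beta> + 2 * (1 - cos \<theta>) - \<theta>\<^sup>2"
proof -
  define A where "A = 1 - cos \<theta>"
  define B where "B = \<theta> - sin \<theta>"
  have A: "0 < A" using cos_less_one[OF assms(1,2)] by (simp add: A_def)
  have B: "0 < B" using sin_less_self[OF assms(1)] by (simp add: B_def)
  have sq: "(\<theta> - B)\<^sup>2 = 2 * A - A\<^sup>2"
    using sin_cos_squared_add[of \<theta>] by (simp add: A_def B_def power2_eq_square algebra_simps)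
  have "A * A * (2 * B * (B / A) + 2 * A - \<theta>\<^sup>2) = 2 * A * B\<^sup>2 + 2 * A^3 - A\<^sup>2 * \<theta>\<^sup>2"
    using A by (simp add: power2_eq_square power3_eq_cube field_simps)
  also have "\<dots> = (A\<^sup>2 - B * (\<theta> - B))\<^sup>2"
  proof -
    have "(A\<^sup>2 - B * (\<theta> - B))\<^sup>2 = A^4 - 2 * A\<^sup>2 * B * (\<theta> - B) + B\<^sup>2 * (\<theta> - B)\<^sup>2"
      by (simp add: power2_eq_square power4_eq_xxxx algebra_simps)
    moreover have "A^4 = A\<^sup>2 * (2 * A - (\<theta> - B)\<^sup>2)"
      unfolding sq by (simp add: power2_eq_square power4_eq_xxxx algebra_simps)
    moreover have "B\<^sup>2 * (\<theta> - B)\<^sup>2 = B\<^sup>2 * (2 * A - A\<^sup>2)" by (simp add: sq)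
    ultimately show ?thesis by (simp add: power2_eq_square power3_eq_cube algebra_simps)
  qed
  finally have "0 \<le> A * A * (2 * B * (B / A) + 2 * A - \<theta>\<^sup>2)" by simp
  then have "0 \<le> 2 * B * (B / A) + 2 * A - \<theta>\<^sup>2"
    using A mult_pos_pos[OF A A] unfolding zero_le_mult_iff by linarith
  also have "\<dots> \<le> 2 * B * \<beta> + 2 * A - \<theta>\<^sup>2"
    using assms(3) B mult_left_mono[of "B / A" \<beta> "2 * B"]
    by (simp add: psi_def A_def[symmetric] B_def[symmetric])
  finally show ?thesis by (simp add: A_def B_def)
qed

lemma cyc_length_le_Lambda:
  assumes "0 < \<beta>" "\<theta> \<in> {0<..psi_inv \<beta>}"
  shows "(cyc_length \<beta>)\<^sup>2 / 2 \<le> Lambda \<beta> \<theta>"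
proof -
  have \<theta>: "0 < \<theta>" "\<theta> < 2 * pi" using assms psi_inv_in[OF assms(1)] by auto
  then have "psi \<theta> \<le> \<beta>" using le_psi_inv_iff[OF assms(1), of \<theta>] assms(2) by simp
  define A where "A = 1 - cos \<theta>"
  define B where "B = \<theta> - sin \<theta>"
  define R where "R = sqrt (2 * B * \<beta> + 2 * A - \<theta>\<^sup>2)"
  \<comment> \<open>The larger root of the quadratic for the initial slope, as
    \<open>Lambda_eq\<close> requires: \<open>B * s + A\<close> is the root
    \<open>R\<close>.\<close>
  define s where "s = (R - A) / B"
  have B: "0 < B" using sin_less_self[OF \<theta>(1)] by (simp add: B_def)
  have R2: "R\<^sup>2 = 2 * B * \<beta> + 2 * A - \<theta>\<^sup>2" and R: "0 \<le> R"
    using discriminant_nonneg[OF \<theta> \<open>psi \<theta> \<le> \<beta>\<close>] by (auto simp: R_def A_def B_def)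
  have sq: "(\<theta> - B)\<^sup>2 = 2 * A - A\<^sup>2"
    using sin_cos_squared_add[of \<theta>] by (simp add: A_def B_def power2_eq_square algebra_simps)
  have Bs: "B * s + A = R" using B by (simp add: s_def)
  have "2 * B * (B * s\<^sup>2 / 2 + A * s + (\<theta> + (\<theta> - B)) / 2) = (B * s + A)\<^sup>2 - A\<^sup>2 + B * (2 * \<theta> - B)"
    by (simp add: power2_eq_square field_simps)
  also have "\<dots> = 2 * B * \<beta>" unfolding Bs R2 using sq by (simp add: power2_eq_square algebra_simps)
  finally have "B * s\<^sup>2 / 2 + A * s + (\<theta> + (\<theta> - B)) / 2 = \<beta>" using B by simp
  then have quad: "(\<theta> - sin \<theta>) * s\<^sup>2 / 2 + (1 - cos \<theta>) * s + (\<theta> + sin \<theta>) / 2 = \<beta>"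
    by (simp add: A_def B_def)
  obtain v1 where "0 \<le> v1" "dH (0, 1) (\<beta>, v1) \<le> \<theta> * sqrt (1 + s\<^sup>2)"
    using cycloid_dH_le[OF \<theta>(1) quad] .
  then have "cyc_length \<beta> \<le> \<theta> * sqrt (1 + s\<^sup>2)"
    using cyc_length_le_dH[OF _ assms(1), of v1] by linarith
  moreover have "0 \<le> cyc_length \<beta>"
    using cyc_angle_pos[OF assms(1)] cos_cyc_angle_pos[of \<beta>] by (simp add: cyc_length_def)
  moreover have "Lambda \<beta> \<theta> = (\<theta> * sqrt (1 + s\<^sup>2))\<^sup>2 / 2"
    using Lambda_eq[OF \<theta>(1) quad] Bs R by (simp add: A_def B_def)
  ultimately show ?thesis by (simp add: power_mono)
qed

text \<open>Identifies the optimal cycloid in the family: rolling angle \<open>2 * a\<close> and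
  initial slope \<open>tan a\<close>. Multiplied by \<open>(cos a)^2\<close>, both sides become
  \<open>a + sin a * cos a\<close>.\<close>

lemma cyc_angle_quadratic:
  fixes \<beta> :: real
  defines "a \<equiv> cyc_angle \<beta>"
  shows "(2 * a - sin (2 * a)) * (tan a)\<^sup>2 / 2 + (1 - cos (2 * a)) * tan a + (2 * a + sin (2 * a)) / 2 = \<beta>"
proof -
  define C where "C = cos a"
  define S where "S = sin a"
  have C: "0 < C" and \<beta>: "a / C\<^sup>2 + S / C = \<beta>"
    using cos_cyc_angle_pos[of \<beta>] cyc_slope_cyc_angle[of \<beta>]
    by (auto simp: a_def C_def S_def cyc_slope_def tan_def)
  have S2: "S\<^sup>2 = 1 - C\<^sup>2" using sin_squared_eq[of a] by (simp add: S_def C_def)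
  have "C\<^sup>2 * ((2 * a - 2 * S * C) * (S / C)\<^sup>2 / 2 + (1 - (1 - 2 * S\<^sup>2)) * (S / C) + (2 * a + 2 * S * C) / 2)
     = a * (S\<^sup>2 + C\<^sup>2) + S * C * (S\<^sup>2 + C\<^sup>2)"
    using C by (simp add: field_simps power2_eq_square)
  also have "\<dots> = C\<^sup>2 * (a / C\<^sup>2 + S / C)"
    using C by (simp add: S2) (simp add: field_simps power2_eq_square)
  finally show ?thesis
    using C unfolding \<beta> by (simp add: tan_def sin_double cos_double_sin S_def C_def)
qed

lemma cyc_length_eq_tan: "2 * cyc_angle \<beta> * sqrt (1 + (tan (cyc_angle \<beta>))\<^sup>2) = cyc_length \<beta>"
proof -
  have "1 + (tan (cyc_angle \<beta>))\<^sup>2 = (inverse (cos (cyc_angle \<beta>)))\<^sup>2"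
    using tan_sec[of "cyc_angle \<beta>"] cos_cyc_angle_pos[of \<beta>] by simp
  then show ?thesis using cos_cyc_angle_pos[of \<beta>] by (simp add: cyc_length_def divide_inverse)
qed

theorem theorem2p5:
  fixes \<beta> :: real
  assumes "\<beta> > 0"
  shows "Dbg \<beta> 0 = (INF \<theta>\<in>{0<..psi_inv \<beta>}. Lambda \<beta> \<theta>)"
proof -
  define a where "a = cyc_angle \<beta>"
  have a: "0 < a" "a < pi/2"
    using cyc_angle_pos[OF assms] cyc_angle_less[of \<beta>] by (auto simp: a_def)
  have t: "0 < tan a" using a by (intro tan_gt_zero) auto
  have quad: "(2 * a - sin (2 * a)) * (tan a)\<^sup>2 / 2 + (1 - cos (2 * a)) * tan a
      + (2 * a + sin (2 * a)) / 2 = \<beta>"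
    unfolding a_def by (rule cyc_angle_quadratic)
  have len: "2 * a * sqrt (1 + (tan a)\<^sup>2) = cyc_length \<beta>"
    unfolding a_def by (rule cyc_length_eq_tan)
  have len0: "0 \<le> cyc_length \<beta>" unfolding len[symmetric] using a by simp
  obtain v1 where v1: "0 \<le> v1" "dH (0, 1) (\<beta>, v1) \<le> cyc_length \<beta>"
    using cycloid_dH_le[OF _ quad] a unfolding len by auto
  then have dH_v1: "dH (0, 1) (\<beta>, v1) = cyc_length \<beta>"
    using cyc_length_le_dH[OF v1(1) assms] by simp
  \<comment> \<open>For \<open>\<gamma> = 0\<close> the target is the vertical line; the infimum is
    attained at height \<open>v1\<close>.\<close>
  have "Dbg \<beta> 0 = (cyc_length \<beta>)\<^sup>2 / 2"
    unfolding Dbg_def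
  proof (rule cInf_eq_minimum)
    show "(cyc_length \<beta>)\<^sup>2 / 2 \<in> (\<lambda>v. (1/2) * (dH (0, 1) (\<beta> + 0 * v, v))\<^sup>2) ` {0..}"
      using v1 by (auto intro!: image_eqI[of _ _ v1] simp: dH_v1)
  next
    fix y assume "y \<in> (\<lambda>v. (1/2) * (dH (0, 1) (\<beta> + 0 * v, v))\<^sup>2) ` {0..}"
    then obtain v where "0 \<le> v" "y = (1/2) * (dH (0, 1) (\<beta>, v))\<^sup>2" by auto
    then show "(cyc_length \<beta>)\<^sup>2 / 2 \<le> y"
      using power_mono[OF cyc_length_le_dH[OF _ assms, of v] len0, of 2] by simp
  qed
  moreover have "(INF \<theta>\<in>{0<..psi_inv \<beta>}. Lambda \<beta> \<theta>) = (cyc_length \<beta>)\<^sup>2 / 2"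
  proof (rule cInf_eq_minimum)
    have "2 * a \<le> psi_inv \<beta>"
      using le_psi_inv_iff[OF assms, of "2 * a"] psi_double_cyc_angle_le[OF assms] a
      by (simp add: a_def)
    \<comment> \<open>Since all factors are nonnegative, \<open>tan a\<close> is the larger root,
      the one that \<open>Lambda\<close> selects.\<close>
    moreover have "0 \<le> (2 * a - sin (2 * a)) * tan a + (1 - cos (2 * a))"
      using t a sin_less_self[of "2 * a"] by (intro add_nonneg_nonneg mult_nonneg_nonneg) auto
    then have "Lambda \<beta> (2 * a) = (cyc_length \<beta>)\<^sup>2 / 2"
      using Lambda_eq[OF _ quad] a unfolding len by simp
    ultimately show "(cyc_length \<beta>)\<^sup>2 / 2 \<in> Lambda \<beta> ` {0<..psi_inv \<beta>}"
      using a by (auto intro!: image_eqI[of _ _ "2 * a"])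
  qed (use cyc_length_le_Lambda[OF assms] in auto)
  ultimately show ?thesis by simp
qed

end
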